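(* For every totally ordered set $(X,\le)$, there is an isomorphism of posets $\mathrm{Weak}^{312}(X_\le)\simeq\mathcal{O}(\mathsf{B}(X_\le))$.
   Context: Let $(X,\le)$ be a totally ordered set. For a total order $\preceq$ on $X$, $\mathrm{Inv}(\preceq):=\{(i,j)\in X\times X\mid i<j\text{ and }j\prec i\}$. $\mathrm{Weak}(X_\le)$ is the set of total orders on $X$, with one order below another iff its inversion set is contained in the other's. A total order $\preceq$ is 312-avoiding (relative to $\le$) if there do not exist $a,b,c\in X$ with $a<b<c$ and $c\prec a\prec b$. $\mathrm{Weak}^{312}(X_\le)$ is the subposet of $\mathrm{Weak}(X_\le)$ of 312-avoiding total orders. A subset $C\subseteq X$ is convex if $a\le b\le c$ and $a,c\in C$ imply $b\in C$. A left segment is a convex subset of $X$ (with respect to $\le$) having a minimal element. $\mathsf{B}(X_\le)$ is the set of all pairs $(S,a)$ with $S$ a left segment of $X$ and $a$ its minimal element; $(S,a)$ is said to be pointed at $a$ and is identified with $S$ when convenient. An ornamentation of $\mathsf{B}(X_\le)$ is a function $\rho:X\to\mathsf{B}(X_\le)$ such that $\rho(a)$ is pointed at $a$ for all $a\in X$, and $\rho(b)\subseteq\rho(a)$ whenever $b\in\rho(a)$. $\mathcal{O}(\mathsf{B}(X_\le))$ is the set of ornamentations ordered by $\rho_1\preceq\rho_2$ iff $\rho_1(a)\subseteq\rho_2(a)$ for all $a\in X$. *)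

theory Defs
  imports Main "HOL-Library.FuncSet"
begin

text \<open>A totally ordered set is a carrier \<open>X\<close> (possibly empty) with a reflexive relation \<open>le\<close>
  satisfying \<^term>\<open>linear_order_on X le\<close>; in particular \<open>le \<subseteq> X \<times> X\<close>, so that distinct elements of
  \<open>weak X\<close> really are distinct orders on \<open>X\<close>. The strict part of an order \<open>r\<close> is \<open>r - Id\<close>.\<close>

definition inversions :: "'a set \<Rightarrow> 'a rel \<Rightarrow> 'a rel \<Rightarrow> ('a \<times> 'a) set" where
  "inversions X le r = {(i, j) \<in> X \<times> X. (i, j) \<in> le - Id \<and> (j, i) \<in> r - Id}"

definition weak :: "'a set \<Rightarrow> 'a rel set" where
  "weak X = {r. linear_order_on X r}"

definition weak_le :: "'a set \<Rightarrow> 'a rel \<Rightarrow> 'a rel \<Rightarrow> 'a rel \<Rightarrow> bool" where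
  "weak_le X le r s \<longleftrightarrow> inversions X le r \<subseteq> inversions X le s"

definition avoids_312 :: "'a set \<Rightarrow> 'a rel \<Rightarrow> 'a rel \<Rightarrow> bool" where
  "avoids_312 X le r \<longleftrightarrow>
     \<not> (\<exists>a\<in>X. \<exists>b\<in>X. \<exists>c\<in>X.
          (a, b) \<in> le - Id \<and> (b, c) \<in> le - Id \<and> (c, a) \<in> r - Id \<and> (a, b) \<in> r - Id)"

definition weak_312 :: "'a set \<Rightarrow> 'a rel \<Rightarrow> 'a rel set" where
  "weak_312 X le = {r \<in> weak X. avoids_312 X le r}"

definition convex_subset :: "'a set \<Rightarrow> 'a rel \<Rightarrow> 'a set \<Rightarrow> bool" where
  "convex_subset X le C \<longleftrightarrow>
     C \<subseteq> X \<and> (\<forall>a\<in>C. \<forall>c\<in>C. \<forall>b\<in>X. (a, b) \<in> le \<and> (b, c) \<in> le \<longrightarrow> b \<in> C)"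

definition minimal_element :: "'a rel \<Rightarrow> 'a set \<Rightarrow> 'a \<Rightarrow> bool" where
  "minimal_element le S a \<longleftrightarrow> a \<in> S \<and> \<not> (\<exists>b\<in>S. (b, a) \<in> le - Id)"

definition left_segment :: "'a set \<Rightarrow> 'a rel \<Rightarrow> 'a set \<Rightarrow> bool" where
  "left_segment X le S \<longleftrightarrow> convex_subset X le S \<and> (\<exists>a. minimal_element le S a)"

definition pointed_left_segments :: "'a set \<Rightarrow> 'a rel \<Rightarrow> ('a set \<times> 'a) set" where
  "pointed_left_segments X le = {(S, a). left_segment X le S \<and> minimal_element le S a}"

text \<open>Functions on \<open>X\<close> are made extensional by \<open>\<rightarrow>\<^sub>E\<close>, so that they are determined by their values
  on \<open>X\<close>. For \<open>\<rho> a = (S, a)\<close>, the underlying segment \<open>S\<close> is \<open>fst (\<rho> a)\<close> and the point is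
  \<open>snd (\<rho> a)\<close>.\<close>

definition ornamentations :: "'a set \<Rightarrow> 'a rel \<Rightarrow> ('a \<Rightarrow> 'a set \<times> 'a) set" where
  "ornamentations X le =
     {\<rho> \<in> X \<rightarrow>\<^sub>E pointed_left_segments X le.
        (\<forall>a\<in>X. snd (\<rho> a) = a) \<and>
        (\<forall>a\<in>X. \<forall>b\<in>X. b \<in> fst (\<rho> a) \<longrightarrow> fst (\<rho> b) \<subseteq> fst (\<rho> a))}"

definition ornamentation_le ::
    "'a set \<Rightarrow> ('a \<Rightarrow> 'a set \<times> 'a) \<Rightarrow> ('a \<Rightarrow> 'a set \<times> 'a) \<Rightarrow> bool" where
  "ornamentation_le X \<rho>\<^sub>1 \<rho>\<^sub>2 \<longleftrightarrow> (\<forall>a\<in>X. fst (\<rho>\<^sub>1 a) \<subseteq> fst (\<rho>\<^sub>2 a))"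

definition poset_isomorphism ::
    "'a set \<Rightarrow> ('a \<Rightarrow> 'a \<Rightarrow> bool) \<Rightarrow> 'b set \<Rightarrow> ('b \<Rightarrow> 'b \<Rightarrow> bool) \<Rightarrow> ('a \<Rightarrow> 'b) \<Rightarrow> bool" where
  "poset_isomorphism A leA B leB f \<longleftrightarrow>
     bij_betw f A B \<and> (\<forall>x\<in>A. \<forall>y\<in>A. leA x y \<longleftrightarrow> leB (f x) (f y))"

text \<open>Both sides are indeed posets.\<close>

lemma weak_le_antisym:
  assumes le: "linear_order_on X le" and r: "r \<in> weak X" and s: "s \<in> weak X"
    and rs: "weak_le X le r s" and sr: "weak_le X le s r"
  shows "r = s"
proof -
  have eq: "inversions X le r = inversions X le s"
    using rs sr by (auto simp: weak_le_def)
  have sub: "p \<subseteq> q"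
    if p: "linear_order_on X p" and q: "linear_order_on X q"
      and e: "inversions X le p = inversions X le q" for p q
  proof (rule subrelI)
    fix x y assume xy: "(x, y) \<in> p"
    have X: "x \<in> X" "y \<in> X"
      using p xy by (auto simp: order_on_defs)
    show "(x, y) \<in> q"
    proof (cases "x = y")
      case True
      then show ?thesis using q X by (auto simp: order_on_defs refl_on_def)
    next
      case False
      consider "(x, y) \<in> le" | "(y, x) \<in> le"
        using le X False by (auto simp: order_on_defs total_on_def)
      then show ?thesis
      proof cases
        case 1
        have "(y, x) \<notin> p"
          using p xy False by (auto simp: order_on_defs antisym_def)
        then have "(x, y) \<notin> inversions X le q"
          using e[symmetric] by (auto simp: inversions_def)
        then have "(y, x) \<notin> q"
          using 1 False X by (auto simp: inversions_def)
        then show ?thesis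
          using q X False by (auto simp: order_on_defs total_on_def)
      next
        case 2
        then have "(y, x) \<in> inversions X le p"
          using xy False X by (auto simp: inversions_def)
        then show ?thesis
          using e by (auto simp: inversions_def)
      qed
    qed
  qed
  show ?thesis
    using sub[of r s] sub[of s r] r s eq by (auto simp: weak_def)
qed

lemma partial_order_on_weak:
  assumes "linear_order_on X le"
  shows "partial_order_on (weak X) (relation_of (weak_le X le) (weak X))"
proof (rule partial_order_on_relation_ofI)
  show "r = s" if "r \<in> weak X" "s \<in> weak X" "weak_le X le r s" "weak_le X le s r" for r s
    using weak_le_antisym[OF assms that] .
qed (auto simp: weak_le_def)

lemma partial_order_on_weak_312:
  assumes "linear_order_on X le"
  shows "partial_order_on (weak_312 X le) (relation_of (weak_le X le) (weak_312 X le))"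
proof (rule partial_order_on_relation_ofI)
  show "r = s"
    if "r \<in> weak_312 X le" "s \<in> weak_312 X le" "weak_le X le r s" "weak_le X le s r" for r s
    using weak_le_antisym[OF assms] that by (simp add: weak_312_def)
qed (auto simp: weak_le_def)

lemma partial_order_on_ornamentations:
  "partial_order_on (ornamentations X le) (relation_of (ornamentation_le X) (ornamentations X le))"
proof (rule partial_order_on_relation_ofI)
  fix f g assume f: "f \<in> ornamentations X le" and g: "g \<in> ornamentations X le"
    and "ornamentation_le X f g" "ornamentation_le X g f"
  then have "f x = g x" if "x \<in> X" for x
    using that by (intro prod_eqI) (auto simp: ornamentations_def ornamentation_le_def)
  then show "f = g"
    using f g by (auto simp: ornamentations_def intro: PiE_ext)
qed (auto simp: ornamentation_le_def)

end

theory Submission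
  imports Defs
begin

text \<open>Write \<open>a < c\<close> for the given order and \<open>c \<prec> a\<close> for another total order \<open>r\<close>. Everything rests on
  the sets \<open>S a = {c. a \<le> c \<and> c \<preceq> a}\<close>, which list the inversions of \<open>r\<close> by their smaller entry, together
  with \<open>a\<close> itself. Inclusion of inversion sets is therefore the same as inclusion of all the \<open>S a\<close>, and
  since an order is determined by its inversions, \<open>r \<mapsto> S\<close> is an order embedding on all of \<open>weak X\<close>.

  The conditions on an ornamentation are the ones needed for \<open>S\<close> to come from a 312-avoiding order.
  For \<open>a < b < c\<close> and \<open>c \<prec> a\<close>, avoiding 312 forces \<open>b \<prec> a\<close>, which is convexity of \<open>S a\<close>
  (\<open>convex_inverted_above\<close>); nesting, \<open>S b \<subseteq> S a\<close> for \<open>b \<in> S a\<close>, is transitivity of \<open>\<le>\<close> and \<open>\<preceq>\<close>.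

  Conversely, let \<open>\<rho>\<close> be an ornamentation and invert exactly the pairs \<open>a < c\<close> with \<open>c\<close> in the segment
  of \<open>a\<close>. A set of pairs \<open>a < c\<close> is the inversion set of a total order as soon as both it and
  its complement are transitive. Nesting gives the first; convexity gives more than the second: if \<open>(a, c)\<close>
  is inverted and \<open>a < b < c\<close> then already \<open>(a, b)\<close> is inverted. This last property is 312-avoidance
  again (\<open>order_of_ornamentation_in_weak_312\<close>).\<close>

definition inverted_above :: "'a rel \<Rightarrow> 'a rel \<Rightarrow> 'a \<Rightarrow> 'a set" where
  "inverted_above le r a = {c. (a, c) \<in> le \<and> (c, a) \<in> r}"

definition ornamentation_of_order :: "'a set \<Rightarrow> 'a rel \<Rightarrow> 'a rel \<Rightarrow> 'a \<Rightarrow> 'a set \<times> 'a" where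
  "ornamentation_of_order X le r = (\<lambda>a\<in>X. (inverted_above le r a, a))"

text \<open>The reflexive pairs enter through the first disjunct, as each segment contains its point.\<close>

definition order_of_ornamentation :: "'a set \<Rightarrow> 'a rel \<Rightarrow> ('a \<Rightarrow> 'a set \<times> 'a) \<Rightarrow> 'a rel" where
  "order_of_ornamentation X le \<rho> =
     {(x, y) \<in> X \<times> X. x \<in> fst (\<rho> y) \<or> ((x, y) \<in> le \<and> y \<notin> fst (\<rho> x))}"

lemma linear_order_onD:
  assumes "linear_order_on X r"
  shows "r \<subseteq> X \<times> X"
    and "x \<in> X \<Longrightarrow> (x, x) \<in> r"
    and "(x, y) \<in> r \<Longrightarrow> (y, z) \<in> r \<Longrightarrow> (x, z) \<in> r"
    and "(x, y) \<in> r \<Longrightarrow> (y, x) \<in> r \<Longrightarrow> x = y"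
    and "x \<in> X \<Longrightarrow> y \<in> X \<Longrightarrow> (x, y) \<in> r \<or> (y, x) \<in> r"
  using assms
  by (auto simp: order_on_defs refl_on_def total_on_def antisym_def dest: transD) metis

lemma weak_le_iff_inverted_above:
  assumes le: "linear_order_on X le" and r: "linear_order_on X r" and s: "linear_order_on X s"
  shows "weak_le X le r s \<longleftrightarrow> (\<forall>a\<in>X. inverted_above le r a \<subseteq> inverted_above le s a)"
  using linear_order_onD(1)[OF le] linear_order_onD(2)[OF s]
  unfolding weak_le_def inversions_def inverted_above_def by blast

text \<open>If \<open>b\<close> lies between \<open>a\<close> and some \<open>c\<close> in the set but were not inverted with \<open>a\<close>, then \<open>c \<prec> a \<prec> b\<close>
  would be a 312 pattern. The lower endpoint \<open>d\<close> of the convexity condition serves only to give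
  \<open>a \<le> d \<le> b\<close>.\<close>

lemma convex_inverted_above:
  assumes le: "linear_order_on X le" and r: "r \<in> weak_312 X le" and a: "a \<in> X"
  shows "convex_subset X le (inverted_above le r a)"
  unfolding convex_subset_def
proof (intro conjI ballI impI)
  show "inverted_above le r a \<subseteq> X"
    using linear_order_onD(1)[OF le] by (auto simp: inverted_above_def)
next
  have lin: "linear_order_on X r" and av: "avoids_312 X le r"
    using r by (auto simp: weak_312_def weak_def)
  fix d c b
  assume d: "d \<in> inverted_above le r a" and c: "c \<in> inverted_above le r a" and b: "b \<in> X"
    and db: "(d, b) \<in> le \<and> (b, c) \<in> le"
  have ab: "(a, b) \<in> le"
    using d db linear_order_onD(3)[OF le] by (auto simp: inverted_above_def)
  have ca: "(a, c) \<in> le" "(c, a) \<in> r" "c \<in> X"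
    using c linear_order_onD(1)[OF le] by (auto simp: inverted_above_def)
  have "(b, a) \<in> r"
  proof (rule ccontr)
    assume n: "(b, a) \<notin> r"
    then have "(a, b) \<in> r" "a \<noteq> b" "b \<noteq> c"
      using linear_order_onD(5)[OF lin a b] linear_order_onD(2)[OF lin a] ca by auto
    moreover have "a \<noteq> c"
      using linear_order_onD(4)[OF le ab] db \<open>a \<noteq> b\<close> by auto
    ultimately show False
      using av ab db ca a b unfolding avoids_312_def by blast
  qed
  with ab show "b \<in> inverted_above le r a"
    by (simp add: inverted_above_def)
qed

lemma ornamentation_of_order_in_ornamentations:
  assumes le: "linear_order_on X le" and r: "r \<in> weak_312 X le"
  shows "ornamentation_of_order X le r \<in> ornamentations X le"
proof -
  have lin: "linear_order_on X r"
    using r by (simp add: weak_312_def weak_def)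
  have "minimal_element le (inverted_above le r a) a" if "a \<in> X" for a
    using that linear_order_onD(2,4)[OF le] linear_order_onD(2)[OF lin]
    by (auto simp: minimal_element_def inverted_above_def)
  then have "(inverted_above le r a, a) \<in> pointed_left_segments X le" if "a \<in> X" for a
    using that convex_inverted_above[OF le r]
    by (auto simp: pointed_left_segments_def left_segment_def)
  moreover have "inverted_above le r b \<subseteq> inverted_above le r a" if "b \<in> inverted_above le r a" for a b
    using that linear_order_onD(3)[OF le] linear_order_onD(3)[OF lin]
    unfolding inverted_above_def by blast
  ultimately show ?thesis
    by (auto simp: ornamentations_def ornamentation_of_order_def)
qed

lemma ornamentationD:
  assumes le: "linear_order_on X le" and \<rho>: "\<rho> \<in> ornamentations X le" and a: "a \<in> X"
  shows "a \<in> fst (\<rho> a)"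
    and "c \<in> fst (\<rho> a) \<Longrightarrow> c \<in> X"
    and "c \<in> fst (\<rho> a) \<Longrightarrow> (a, c) \<in> le"
    and "c \<in> fst (\<rho> a) \<Longrightarrow> (a, b) \<in> le \<Longrightarrow> (b, c) \<in> le \<Longrightarrow> b \<in> fst (\<rho> a)"
    and "b \<in> fst (\<rho> a) \<Longrightarrow> c \<in> fst (\<rho> b) \<Longrightarrow> c \<in> fst (\<rho> a)"
proof -
  have "\<rho> a \<in> pointed_left_segments X le" and pt: "snd (\<rho> a) = a"
    using \<rho> a by (auto simp: ornamentations_def)
  then have cv: "convex_subset X le (fst (\<rho> a))" and mn: "minimal_element le (fst (\<rho> a)) a"
    by (auto simp: pointed_left_segments_def left_segment_def split: prod.splits)
  show aa: "a \<in> fst (\<rho> a)"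
    using mn by (simp add: minimal_element_def)
  show X: "c \<in> X" if "c \<in> fst (\<rho> a)" for c
    using cv that by (auto simp: convex_subset_def)
  show "(a, c) \<in> le" if "c \<in> fst (\<rho> a)"
    using mn that linear_order_onD(2)[OF le a] linear_order_onD(5)[OF le a X[OF that]]
    by (auto simp: minimal_element_def)
  show "b \<in> fst (\<rho> a)" if "c \<in> fst (\<rho> a)" "(a, b) \<in> le" "(b, c) \<in> le"
    using cv aa that linear_order_onD(1)[OF le] unfolding convex_subset_def by blast
  show "c \<in> fst (\<rho> a)" if "b \<in> fst (\<rho> a)" "c \<in> fst (\<rho> b)"
    using \<rho> a X that unfolding ornamentations_def by blast
qed

text \<open>For transitivity the four cases record which of the two consecutive pairs are inverted. The two
  unmixed cases are transitivity of the inversions (nesting) and of the non-inversions (convexity); the mixed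
  cases follow from these two once \<open>x\<close> and \<open>z\<close> are compared. In the 312 pattern \<open>c \<prec> a \<prec> b\<close>, convexity
  of the segment of \<open>a\<close> would put \<open>b\<close> in it and so invert \<open>(a, b)\<close> as well.\<close>

lemma order_of_ornamentation_in_weak_312:
  assumes le: "linear_order_on X le" and \<rho>: "\<rho> \<in> ornamentations X le"
  shows "order_of_ornamentation X le \<rho> \<in> weak_312 X le"
proof -
  let ?r = "order_of_ornamentation X le \<rho>"
  note leD = linear_order_onD[OF le]
  note \<rho>D = ornamentationD[OF le \<rho>]
  have r_iff: "(x, y) \<in> ?r \<longleftrightarrow> x \<in> X \<and> y \<in> X \<and> (x \<in> fst (\<rho> y) \<or> (x, y) \<in> le \<and> y \<notin> fst (\<rho> x))" for x y
    by (simp add: order_of_ornamentation_def)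
  have trans: "(x, z) \<in> ?r" if xy: "(x, y) \<in> ?r" and yz: "(y, z) \<in> ?r" for x y z
  proof -
    have X: "x \<in> X" "y \<in> X" "z \<in> X"
      using xy yz by (auto simp: r_iff)
    consider (inv_inv) "x \<in> fst (\<rho> y)" "y \<in> fst (\<rho> z)"
      | (inv_non) "x \<in> fst (\<rho> y)" "(y, z) \<in> le" "z \<notin> fst (\<rho> y)"
      | (non_inv) "(x, y) \<in> le" "y \<notin> fst (\<rho> x)" "y \<in> fst (\<rho> z)"
      | (non_non) "(x, y) \<in> le" "y \<notin> fst (\<rho> x)" "(y, z) \<in> le" "z \<notin> fst (\<rho> y)"
      using xy yz by (auto simp: r_iff)
    then show ?thesis
    proof cases
      case inv_inv
      then show ?thesis using X \<rho>D(5) by (auto simp: r_iff)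
    next
      case inv_non
      \<comment> \<open>Convexity of the segment of \<open>y\<close> puts \<open>z\<close> above \<open>x\<close>; nesting of the segment of \<open>x\<close> in that of
        \<open>y\<close> keeps \<open>z\<close> out of it.\<close>
      then have "(x, z) \<in> le" "z \<notin> fst (\<rho> x)"
        using leD(5)[OF X(1) X(3)] \<rho>D(4)[OF X(2)] \<rho>D(5)[OF X(2)] by blast+
      then show ?thesis using X by (simp add: r_iff)
    next
      case non_inv
      show ?thesis
      proof (cases "(z, x) \<in> le")
        case True
        then have "x \<in> fst (\<rho> z)"
          using \<rho>D(4)[OF X(3)] non_inv by blast
        then show ?thesis using X by (simp add: r_iff)
      next
        case False
        \<comment> \<open>Now \<open>x \<le> z \<le> y\<close>, so if the segment of \<open>x\<close> reached \<open>z\<close> it would contain that of \<open>z\<close>, hence \<open>y\<close>.\<close>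
        then have "(x, z) \<in> le" "z \<notin> fst (\<rho> x)"
          using leD(5)[OF X(1) X(3)] \<rho>D(5)[OF X(1)] non_inv by blast+
        then show ?thesis using X by (simp add: r_iff)
      qed
    next
      case non_non
      then have "(x, z) \<in> le" "z \<notin> fst (\<rho> x)"
        using leD(3) \<rho>D(4)[OF X(1)] by blast+
      then show ?thesis using X by (simp add: r_iff)
    qed
  qed
  have "linear_order_on X ?r"
    unfolding order_on_defs refl_on_def total_on_def
  proof (intro conjI ballI impI)
    show "?r \<subseteq> X \<times> X"
      by (auto simp: r_iff)
    show "trans ?r"
      using trans by (rule transI)
    show "antisym ?r"
      using leD(4) \<rho>D(3) by (intro antisymI) (auto simp: r_iff)
    show "(x, x) \<in> ?r" if "x \<in> X" for x
      using that \<rho>D(1) by (simp add: r_iff)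
    show "(x, y) \<in> ?r \<or> (y, x) \<in> ?r" if "x \<in> X" "y \<in> X" for x y
      using that leD(5)[OF that] by (auto simp: r_iff)
  qed
  moreover have "avoids_312 X le ?r"
    unfolding avoids_312_def
  proof (intro notI, elim bexE)
    fix a b c
    assume X: "a \<in> X" "b \<in> X" "c \<in> X"
      and pat: "(a, b) \<in> le - Id \<and> (b, c) \<in> le - Id \<and> (c, a) \<in> ?r - Id \<and> (a, b) \<in> ?r - Id"
    then have ab: "(a, b) \<in> le" "a \<noteq> b" and bc: "(b, c) \<in> le"
      and ca: "(c, a) \<in> ?r" "c \<noteq> a" and rab: "(a, b) \<in> ?r"
      by auto
    have "(a, c) \<in> le" using leD(3) ab bc by blast
    then have "c \<in> fst (\<rho> a)" using ca leD(4) by (auto simp: r_iff)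
    then have "b \<in> fst (\<rho> a)" using \<rho>D(4)[OF X(1)] ab bc by blast
    then show False using rab ab leD(4) \<rho>D(3)[OF X(2)] by (auto simp: r_iff)
  qed
  ultimately show ?thesis
    by (simp add: weak_312_def weak_def)
qed

lemma ornamentation_of_order_of_ornamentation:
  assumes le: "linear_order_on X le" and \<rho>: "\<rho> \<in> ornamentations X le"
  shows "ornamentation_of_order X le (order_of_ornamentation X le \<rho>) = \<rho>"
proof
  fix a
  note \<rho>D = ornamentationD[OF le \<rho>]
  show "ornamentation_of_order X le (order_of_ornamentation X le \<rho>) a = \<rho> a"
  proof (cases "a \<in> X")
    case True
    have "inverted_above le (order_of_ornamentation X le \<rho>) a = fst (\<rho> a)"
      using \<rho>D(1-3)[OF True] True linear_order_onD(4)[OF le]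
      by (auto simp: inverted_above_def order_of_ornamentation_def)
    moreover have "snd (\<rho> a) = a"
      using \<rho> True by (simp add: ornamentations_def)
    ultimately show ?thesis
      using True by (simp add: ornamentation_of_order_def prod_eq_iff)
  next
    case False
    then show ?thesis
      using \<rho> by (auto simp: ornamentation_of_order_def ornamentations_def PiE_def extensional_def)
  qed
qed

theorem proposition7p8:
  fixes X :: "'a set" and le :: "'a rel"
  assumes "linear_order_on X le"
  shows "\<exists>f. poset_isomorphism (weak_312 X le) (weak_le X le)
               (ornamentations X le) (ornamentation_le X) f"
proof -
  let ?f = "ornamentation_of_order X le"
  have mono: "weak_le X le r s \<longleftrightarrow> ornamentation_le X (?f r) (?f s)"
    if "r \<in> weak_312 X le" "s \<in> weak_312 X le" for r s
    using that weak_le_iff_inverted_above[OF assms, of r s]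
    by (simp add: weak_312_def weak_def ornamentation_le_def ornamentation_of_order_def)
  have "inj_on ?f (weak_312 X le)"
  proof (rule inj_onI)
    fix r s assume r: "r \<in> weak_312 X le" and s: "s \<in> weak_312 X le" and eq: "?f r = ?f s"
    have "weak_le X le r s" "weak_le X le s r"
      using mono[OF r s] mono[OF s r] eq by (auto simp: ornamentation_le_def)
    then show "r = s"
      using weak_le_antisym[OF assms] r s by (simp add: weak_312_def)
  qed
  moreover have "?f ` weak_312 X le = ornamentations X le"
  proof (intro equalityI subsetI)
    show "\<rho> \<in> ornamentations X le" if "\<rho> \<in> ?f ` weak_312 X le" for \<rho>
      using that ornamentation_of_order_in_ornamentations[OF assms] by auto
    show "\<rho> \<in> ?f ` weak_312 X le" if "\<rho> \<in> ornamentations X le" for \<rho>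
      using order_of_ornamentation_in_weak_312[OF assms that]
        ornamentation_of_order_of_ornamentation[OF assms that] by (metis imageI)
  qed
  ultimately have "poset_isomorphism (weak_312 X le) (weak_le X le)
      (ornamentations X le) (ornamentation_le X) ?f"
    using mono by (auto simp: poset_isomorphism_def bij_betw_def)
  then show ?thesis by blast
qed

end
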